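(* Let $n = p_1^{k_1}\cdots p_t^{k_t}$ where $t\ge2$, $p_1<\cdots<p_t$ are primes, and $k_1,\dots,k_t$ are positive integers. Then: (a) $$\mathrm{Ap}(S(B_n),n) = \Big\{\sum_{i=1}^{t}\sum_{j=1}^{k_i} c_{i,j}\binom{n}{p_i^{j}} \;\Big|\; c_{i,j}\in\mathbb{Z},\ 0\le c_{i,j}\le p_i-1\Big\};$$ (b) the Frobenius number is $$F(S(B_n)) = \sum_{i=1}^{t}\sum_{j=1}^{k_i}(p_i-1)\binom{n}{p_i^j} - n;$$ (c) the genus is $$g(S(B_n)) = \sum_{i=1}^{t}\sum_{j=1}^{k_i}\frac{p_i-1}{2}\binom{n}{p_i^j} - \frac{n-1}{2};$$ (d) the set of pseudo-Frobenius numbers is $$PF(S(B_n)) = \Big\{\sum_{i=1}^{t}\sum_{j=1}^{k_i}(p_i-1)\binom{n}{p_i^j} - n\Big\},$$ and the type is $t(S(B_n))=1$.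
   Context: $\mathbb{N}$ is the set of nonnegative integers. For nonempty $A\subseteq\mathbb{N}$, $\langle A\rangle$ denotes the submonoid of $(\mathbb{N},+)$ generated by $A$. A numerical semigroup is a submonoid of $\mathbb{N}$ with finite complement. For $n$ not a prime power, $S(B_n) = \left\langle \binom n1,\binom n2,\dots,\binom n{n-1}\right\rangle$, which is a numerical semigroup. For a numerical semigroup $S$: the Frobenius number $F(S)$ is the greatest integer not in $S$; the genus $g(S)$ is the cardinality of $\mathbb{N}\setminus S$; for $x\in S\setminus\{0\}$, $\mathrm{Ap}(S,x)=\{s\in S: s-x\notin S\}$; an integer $x$ is a pseudo-Frobenius number of $S$ if $x\notin S$ and $x+s\in S$ for all $s\in S\setminus\{0\}$; $PF(S)$ is the set of pseudo-Frobenius numbers and the type $t(S)$ is its cardinality. *)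

theory Defs
  imports Complex_Main "HOL-Computational_Algebra.Primes" "HOL-Algebra.Exponent"
begin

definition add_submonoid :: "nat set \<Rightarrow> bool" where
  "add_submonoid M \<longleftrightarrow> 0 \<in> M \<and> (\<forall>x\<in>M. \<forall>y\<in>M. x + y \<in> M)"

definition generated_submonoid :: "nat set \<Rightarrow> nat set" where
  "generated_submonoid A = add_submonoid hull A"

definition numerical_semigroup :: "nat set \<Rightarrow> bool" where
  "numerical_semigroup S \<longleftrightarrow> add_submonoid S \<and> finite (- S)"

definition binomial_semigroup :: "nat \<Rightarrow> nat set" where
  "binomial_semigroup n = generated_submonoid ((\<lambda>i. n choose i) ` {1..n - 1})"

text \<open>
  Differences \<open>s - x\<close>, the Frobenius number and the pseudo-Frobenius numbers are integers
  (the latter two give \<open>-1\<close> for \<open>S = UNIV\<close>), so membership in \<open>S\<close> is tested in \<open>int ` S\<close>;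
  subtraction on \<^typ>\<open>nat\<close> would truncate.
\<close>

definition Apery :: "nat set \<Rightarrow> nat \<Rightarrow> nat set" where
  "Apery S x = {s \<in> S. int s - int x \<notin> int ` S}"

definition Frobenius_number :: "nat set \<Rightarrow> int" where
  "Frobenius_number S = (GREATEST x. x \<notin> int ` S)"

definition genus :: "nat set \<Rightarrow> nat" where
  "genus S = card (- S)"

definition pseudo_Frobenius :: "nat set \<Rightarrow> int set" where
  "pseudo_Frobenius S = {x. x \<notin> int ` S \<and> (\<forall>s\<in>S - {0}. x + int s \<in> int ` S)}"

definition semigroup_type :: "nat set \<Rightarrow> nat" where
  "semigroup_type S = card (pseudo_Frobenius S)"

text \<open>
  \<^const>\<open>Frobenius_number\<close> and \<^const>\<open>genus\<close> are only meaningful on numerical semigroups.  The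
  rest of this theory shows that \<^term>\<open>binomial_semigroup n\<close> is one unless \<open>n\<close> is a prime power,
  and that the Frobenius number of a numerical semigroup is indeed a greatest element.
\<close>

lemma add_submonoid_generated: "add_submonoid (generated_submonoid A)"
  unfolding generated_submonoid_def
  by (rule hull_in) (auto simp: add_submonoid_def)

lemma generated_submonoid_incl: "a \<in> A \<Longrightarrow> a \<in> generated_submonoid A"
  unfolding generated_submonoid_def by (rule hull_inc)

lemma add_submonoid_mult:
  assumes "add_submonoid S" "s \<in> S"
  shows "m * s \<in> S"
  using assms by (induction m) (auto simp: add_submonoid_def)

lemma finite_compl_of_consecutive:
  assumes S: "add_submonoid S" and s: "s \<in> S" "Suc s \<in> S"
  shows "finite (- S)"
proof -
  have "x \<in> S" if x: "x \<ge> s * s" for x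
  proof (cases "s = 0")
    case True
    then show ?thesis using add_submonoid_mult[OF S s(2), of x] by simp
  next
    case False
    define q r where "q = x div s" and "r = x mod s"
    have "r < s" using False by (simp add: r_def)
    moreover have "q \<ge> s" using x False by (simp add: q_def less_eq_div_iff_mult_less_eq)
    ultimately obtain k where k: "q = r + k" using le_Suc_ex[of r q] by auto
    have "x = q * s + r" by (simp add: q_def r_def)
    also have "\<dots> = k * s + r * Suc s" by (simp add: k distrib_right)
    finally have "x = k * s + r * Suc s" .
    then show ?thesis
      using add_submonoid_mult[OF S s(1), of k] add_submonoid_mult[OF S s(2), of r] S
      by (auto simp: add_submonoid_def)
  qed
  then have "- S \<subseteq> {..<s * s}" by (metis Compl_iff lessThan_iff not_le subsetI)
  then show ?thesis by (rule finite_subset) simp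
qed

lemma finite_compl_of_no_common_prime:
  assumes S: "add_submonoid S" and a: "a \<in> S" "a > 0"
    and no_prime: "\<And>q. prime q \<Longrightarrow> \<exists>s\<in>S. \<not> q dvd s"
  shows "finite (- S)"
proof -
  define P where "P = (\<lambda>d::nat. d > 0 \<and> (\<exists>s\<in>S. s + d \<in> S))"
  define d where "d = (LEAST d. P d)"
  have "P a" using a S by (auto simp: P_def add_submonoid_def intro!: bexI[of _ 0])
  then have "P d" unfolding d_def by (rule LeastI)
  then obtain s where d: "d > 0" "s \<in> S" "s + d \<in> S" by (auto simp: P_def)
  have dvd: "d dvd x" if x: "x \<in> S" for x
  proof (rule ccontr)
    assume ndvd: "\<not> d dvd x"
    define q where "q = x div d"
    have eq: "x = q * d + x mod d" by (simp add: q_def)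
    have 1: "q * (s + d) \<in> S" by (rule add_submonoid_mult[OF S d(3)])
    have "q * s + x \<in> S"
      using add_submonoid_mult[OF S d(2), of q] x S by (auto simp: add_submonoid_def)
    moreover have "q * s + x = q * (s + d) + x mod d"
      using eq by (simp add: algebra_simps)
    ultimately have "q * (s + d) + x mod d \<in> S" by simp
    with 1 ndvd have "P (x mod d)" by (auto simp: P_def dvd_eq_mod_eq_0)
    then have "d \<le> x mod d" unfolding d_def by (rule Least_le)
    then show False using d(1) by (meson mod_less_divisor not_le)
  qed
  have "d = 1"
  proof (rule ccontr)
    assume "d \<noteq> 1"
    then obtain q where "prime q" "q dvd d" using prime_factor_nat by blast
    with no_prime dvd show False by (meson dvd_trans)
  qed
  with d show ?thesis by (auto intro: finite_compl_of_consecutive[OF S])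
qed

theorem numerical_semigroup_binomial_semigroup:
  assumes n: "n > 0" and not_prime_power: "\<And>q a. prime q \<Longrightarrow> n \<noteq> q ^ a"
  shows "numerical_semigroup (binomial_semigroup n)"
proof -
  have n1: "n > 1" using n not_prime_power[OF two_is_prime_nat, of 0] by simp
  have gen: "n choose i \<in> binomial_semigroup n" if "0 < i" "i < n" for i
    unfolding binomial_semigroup_def using that by (intro generated_submonoid_incl imageI) auto
  have S: "add_submonoid (binomial_semigroup n)"
    unfolding binomial_semigroup_def by (rule add_submonoid_generated)
  have n_in: "n \<in> binomial_semigroup n" using gen[of 1] n1 by simp
  have "finite (- binomial_semigroup n)"
  proof (rule finite_compl_of_no_common_prime[OF S n_in n])
    fix q :: nat assume q: "prime q"
    define a where "a = multiplicity q n"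
    obtain m where m: "n = q ^ a * m" "\<not> q dvd m"
      using multiplicity_decompose'[of n q] n q unfolding a_def by (metis not_prime_unit less_irrefl)
    have m0: "m > 0" using m n by (auto intro: Nat.gr0I)
    have "m \<noteq> 1" using not_prime_power[OF q, of a] m by auto
    with m0 have "q ^ a < n" using m q by (simp add: prime_gt_0_nat)
    moreover have "q ^ a > 0" using q by (simp add: prime_gt_0_nat)
    ultimately have in_S: "n choose (q ^ a) \<in> binomial_semigroup n" by (intro gen)
    have "multiplicity q (n choose (q ^ a)) = multiplicity q m"
      unfolding m(1) using const_p_fac[OF m0 q] .
    also have "\<dots> = 0" using m(2) by (rule not_dvd_imp_multiplicity_0)
    finally have "\<not> q dvd (n choose (q ^ a))"
      using q \<open>q ^ a < n\<close> by (auto simp: prime_elem_multiplicity_eq_zero_iff)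
    with in_S show "\<exists>s\<in>binomial_semigroup n. \<not> q dvd s" by blast
  qed
  with S show ?thesis by (simp add: numerical_semigroup_def)
qed

lemma Frobenius_number_greatest:
  assumes "numerical_semigroup S"
  shows "Frobenius_number S \<notin> int ` S"
    and "x \<notin> int ` S \<Longrightarrow> x \<le> Frobenius_number S"
proof -
  define X where "X = insert (-1) (int ` (- S))"
  have fin: "finite X" using assms by (simp add: X_def numerical_semigroup_def)
  have X: "x \<in> X" if "x \<notin> int ` S" "x \<ge> -1" for x
    using that by (cases "x = -1") (auto simp: X_def image_iff intro!: bexI[of _ "nat x"])
  have 1: "Max X \<notin> int ` S"
    using Max_in[OF fin] by (auto simp: X_def)
  have 2: "y \<le> Max X" if "y \<notin> int ` S" for y
  proof (cases "y \<ge> -1")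
    case True
    then show ?thesis using X[OF that] fin by simp
  next
    case False
    moreover have "-1 \<le> Max X" using fin by (intro Max_ge) (auto simp: X_def)
    ultimately show ?thesis by simp
  qed
  have "Frobenius_number S = Max X"
    unfolding Frobenius_number_def using 1 2 by (intro Greatest_equality) auto
  with 1 2 show "Frobenius_number S \<notin> int ` S" "x \<notin> int ` S \<Longrightarrow> x \<le> Frobenius_number S"
    by auto
qed

end

theory Submission
  imports Defs "HOL-Number_Theory.Number_Theory"
begin

text \<open>
  Write \<open>P q\<close> for the prime below a prime power \<open>q\<close>.  Each residue class modulo \<open>n\<close> contains
  exactly one sum \<open>\<Sum>q. c q * (n choose q)\<close>, over the prime powers \<open>q\<close> dividing \<open>n\<close>, with digits
  \<open>c q < P q\<close>: such a sum is found one prime factor at a time, since \<open>n choose p ^ j\<close> is \<open>n / p ^ j\<close>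
  times a unit modulo \<open>p\<close>, and it is unique because the \<open>P q\<close> multiply to \<open>n\<close>.  The digit sum of
  \<open>n choose m\<close> involves only proper divisors of \<open>m\<close>, unless \<open>m\<close> is itself one of the \<open>q\<close>, so it is
  at most \<open>n choose m\<close> as binomial coefficients grow quickly; likewise the digit sum of
  \<open>p * (n choose p ^ j)\<close> is at most \<open>n choose p ^ j\<close>, which allows carrying.  Hence a number is
  in the semigroup iff it is at least the digit sum of its residue class.  Complementing digits makes
  the semigroup symmetric, which gives the Frobenius number, the genus and the type.
\<close>

section \<open>Growth estimates for binomial coefficients\<close>

text \<open>Consecutive coefficients have ratio \<open>(n - q) / (q + 1)\<close>, and
  \<open>n - q\<close> is at least \<open>2 * (q + 1)\<close> in this range.\<close>

lemma choose_Suc_ge_double: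
  assumes "3 * q + 2 \<le> n"
  shows "2 * (n choose q) \<le> n choose Suc q"
proof -
  have "Suc q * (n choose Suc q) = (n - q) * (n choose q)"
    using binomial_absorb_comp[of n q] times_binomial_minus1_eq[of "Suc q" n] by simp
  moreover have "Suc q * 2 \<le> n - q" using assms by simp
  ultimately have "Suc q * 2 * (n choose q) \<le> Suc q * (n choose Suc q)"
    by (metis mult_le_mono1)
  then show ?thesis by (simp add: mult.assoc del: mult_Suc)
qed

text \<open>Up to \<open>h\<close> the terms at least double at every step, so the last one
  dominates the sum as in a geometric series.\<close>

lemma sum_choose_le_double:
  assumes "3 * h \<le> n"
  shows "(\<Sum>q\<le>h. n choose q) \<le> 2 * (n choose h)"
  using assms
proof (induction h)
  case (Suc h)
  then show ?case using choose_Suc_ge_double[of h n] by simp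
qed simp

text \<open>The growth factor of the central coefficient, about 4, cleared of denominators for the
  induction in \<open>choose_triple_ge_from_3\<close>.\<close>

lemma choose_double_step:
  "(h + 1) * ((2 * h + 2) choose (h + 1)) = 2 * (2 * h + 1) * ((2 * h) choose h)"
proof -
  have 1: "Suc h * (Suc (2 * h + 1) choose Suc h) = Suc (2 * h + 1) * ((2 * h + 1) choose h)"
    by (rule Suc_times_binomial)
  have "(2 * h + 1 - h) * ((2 * h + 1) choose h) = (2 * h + 1) * ((2 * h) choose h)"
    using binomial_absorb_comp[of "2 * h + 1" h] by simp
  then have 2: "(h + 1) * ((2 * h + 1) choose h) = (2 * h + 1) * ((2 * h) choose h)"
    by simp
  have "(h + 1) * ((2 * h + 2) choose (h + 1)) = 2 * ((h + 1) * ((2 * h + 1) choose h))"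
    using 1 by (simp add: algebra_simps)
  then show ?thesis unfolding 2 by simp
qed

text \<open>The companion recurrence, with growth factor tending to 27/4.\<close>

lemma choose_triple_step:
  "2 * (h + 1) * (2 * h + 1) * ((3 * h + 3) choose (h + 1)) =
     3 * (3 * h + 2) * (3 * h + 1) * ((3 * h) choose h)"
proof -
  have "Suc h * (Suc (3 * h + 2) choose Suc h) = Suc (3 * h + 2) * ((3 * h + 2) choose h)"
    by (rule Suc_times_binomial)
  moreover have "Suc (3 * h + 2) = Suc h * 3" by simp
  ultimately have "Suc h * (Suc (3 * h + 2) choose Suc h) = Suc h * (3 * ((3 * h + 2) choose h))"
    by (metis mult.assoc)
  then have 1: "(3 * h + 3) choose (h + 1) = 3 * ((3 * h + 2) choose h)"
    by (simp add: numeral_3_eq_3 del: mult_Suc binomial_Suc_Suc)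
  have "3 * h + 2 - h = 2 * (h + 1)" "3 * h + 1 - h = 2 * h + 1" by simp_all
  then have 2: "2 * (h + 1) * ((3 * h + 2) choose h) = (3 * h + 2) * ((3 * h + 1) choose h)"
    and 3: "(2 * h + 1) * ((3 * h + 1) choose h) = (3 * h + 1) * ((3 * h) choose h)"
    using binomial_absorb_comp[of "3 * h + 2" h] binomial_absorb_comp[of "3 * h + 1" h] by simp_all
  have "2 * (h + 1) * (2 * h + 1) * ((3 * h + 3) choose (h + 1)) =
      3 * (2 * h + 1) * (2 * (h + 1) * ((3 * h + 2) choose h))"
    unfolding 1 by (simp only: ac_simps)
  also have "\<dots> = 3 * (3 * h + 2) * ((2 * h + 1) * ((3 * h + 1) choose h))"
    unfolding 2 by (simp only: ac_simps)
  also have "\<dots> = 3 * (3 * h + 2) * (3 * h + 1) * ((3 * h) choose h)"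
    unfolding 3 by (simp only: ac_simps)
  finally show ?thesis .
qed

text \<open>The right side gains a factor near 27/4 per step, the left side only one near 4. The
  induction starts at 3 because the comparison \<open>coeff\<close> of these factors still fails at
  \<open>h = 2\<close>; the base case reads 80 \<le> 84.\<close>

lemma choose_triple_ge_from_3:
  assumes "3 \<le> h"
  shows "2 * (h - 1) * ((2 * h) choose h) \<le> (3 * h) choose h"
  using assms
proof (induction rule: dec_induct)
  case base
  show ?case by (simp add: numeral_eq_Suc)
next
  case (step h)
  define A A' B B' where "A = (3 * h) choose h" and "A' = (3 * h + 3) choose (h + 1)"
    and "B = (2 * h) choose h" and "B' = (2 * h + 2) choose (h + 1)"
  define K where "K = 2 * (h + 1) * (2 * h + 1)"
  have IH: "2 * (h - 1) * B \<le> A" using step.IH by (simp add: A_def B_def)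
  have A': "K * A' = 3 * (3 * h + 2) * (3 * h + 1) * A"
    using choose_triple_step[of h] by (simp only: A_def A'_def K_def)
  have B': "(h + 1) * B' = 2 * (2 * h + 1) * B"
    using choose_double_step[of h] by (simp only: B_def B'_def)
  \<comment> \<open>In terms of \<open>d\<close> the truncated \<open>h - 1\<close> disappears and
    \<open>coeff\<close> holds coefficient by coefficient.\<close>
  obtain d where d: "h = d + 3" using step.hyps(1) by (metis add.commute le_Suc_ex)
  have coeff: "8 * h * (2 * h + 1) * (2 * h + 1) \<le> 3 * (3 * h + 2) * (3 * h + 1) * (2 * (h - 1))"
    unfolding d by (simp add: algebra_simps)
  have "K * (2 * h * B') = 4 * h * (2 * h + 1) * ((h + 1) * B')"
    by (simp add: K_def algebra_simps)
  also have "\<dots> = 8 * h * (2 * h + 1) * (2 * h + 1) * B"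
    unfolding B' by (simp add: algebra_simps)
  also have "\<dots> \<le> 3 * (3 * h + 2) * (3 * h + 1) * (2 * (h - 1)) * B"
    using coeff by (rule mult_le_mono1)
  also have "\<dots> \<le> 3 * (3 * h + 2) * (3 * h + 1) * A"
    unfolding mult.assoc using IH by (intro mult_le_mono2) (simp add: ac_simps)
  also have "\<dots> = K * A'" by (simp only: A')
  finally have "K * (2 * h * B') \<le> K * A'" .
  moreover have "K > 0" by (simp add: K_def)
  ultimately have "2 * h * B' \<le> A'" by (metis nat_mult_le_cancel1)
  then show ?case by (simp add: A'_def B'_def algebra_simps)
qed

lemma choose_triple_ge: "2 * (h - 1) * ((2 * h) choose h) \<le> (3 * h) choose h"
proof -
  consider "h = 0" | "h = 1" | "h = 2" | "3 \<le> h" by linarith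
  then show ?thesis
  proof cases
    case 3
    then show ?thesis by (simp add: numeral_eq_Suc)
  next
    case 4
    then show ?thesis by (rule choose_triple_ge_from_3)
  qed simp_all
qed

text \<open>Counting \<open>h\<close>-subsets inside \<open>2 * h\<close>-subsets shows that the
  quotient of the two coefficients is \<open>(n - h) choose h\<close> over
  \<open>(2 * h) choose h\<close>. As \<open>n - h\<close> is at least \<open>3 * h\<close>,
  \<open>choose_triple_ge\<close> applies.\<close>

lemma choose_double_ge:
  assumes "4 * h \<le> n"
  shows "2 * (h - 1) * (n choose h) \<le> n choose (2 * h)"
proof -
  have "(n choose (2 * h)) * ((2 * h) choose h) = (n choose h) * ((n - h) choose h)"
    using choose_mult[of h "2 * h" n] assms by simp
  also have "\<dots> \<ge> (n choose h) * ((3 * h) choose h)"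
    using assms by (intro mult_le_mono2 binomial_right_mono) simp
  finally have "(n choose h) * (2 * (h - 1) * ((2 * h) choose h)) \<le>
      (n choose (2 * h)) * ((2 * h) choose h)"
    using choose_triple_ge[of h] mult_le_mono2 order_trans by blast
  then have "2 * (h - 1) * (n choose h) * ((2 * h) choose h) \<le>
      (n choose (2 * h)) * ((2 * h) choose h)"
    by (simp add: ac_simps)
  then show ?thesis by simp
qed

text \<open>All indices are at most \<open>h = m div 2\<close>, so the weights are at most
  \<open>h - 1\<close> and the unweighted sum is at most \<open>2 * (n choose h)\<close>. The factor
  \<open>2 * (h - 1)\<close> in \<open>choose_double_ge\<close> absorbs both.\<close>

lemma sum_weighted_choose_le:
  assumes A: "\<And>q. q \<in> A \<Longrightarrow> 2 * q \<le> m" and m: "2 * m \<le> n"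
    and c: "\<And>q. q \<in> A \<Longrightarrow> c q < q"
  shows "(\<Sum>q\<in>A. c q * (n choose q)) \<le> n choose m"
proof -
  define h where "h = m div 2"
  have h: "2 * h \<le> m" "4 * h \<le> n" using m by (auto simp: h_def)
  have A_h: "A \<subseteq> {..h}" using A by (force simp: h_def)
  have "(\<Sum>q\<in>A. c q * (n choose q)) \<le> (\<Sum>q\<in>A. (h - 1) * (n choose q))"
    using A_h c by (intro sum_mono mult_le_mono1) (fastforce simp: subset_iff)
  also have "\<dots> \<le> (\<Sum>q\<le>h. (h - 1) * (n choose q))"
    using A_h by (intro sum_mono2) auto
  also have "\<dots> = (h - 1) * (\<Sum>q\<le>h. n choose q)" by (simp add: sum_distrib_left)
  also have "\<dots> \<le> (h - 1) * (2 * (n choose h))"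
    using h by (intro mult_le_mono2 sum_choose_le_double) simp
  also have "\<dots> \<le> n choose (2 * h)" using choose_double_ge[OF h(2)] by (simp add: ac_simps)
  also have "\<dots> \<le> n choose m" using h m by (intro binomial_mono) auto
  finally show ?thesis .
qed


section \<open>Prime power divisors and residues modulo \<open>n\<close>\<close>

text \<open>Absorption makes \<open>m\<close> a divisor; since the coefficient has the same
  multiplicity of \<open>p\<close> as \<open>m\<close>, the cofactor is prime to
  \<open>p\<close>.\<close>

lemma choose_prime_power_cofactor:
  fixes m p :: nat
  assumes m: "m > 0" and p: "prime p"
  obtains u where "p ^ a * m choose p ^ a = m * u" "\<not> p dvd u"
proof
  define u where "u = (p ^ a * m - 1) choose (p ^ a - 1)"
  have p0: "p ^ a > 0" using p by (simp add: prime_gt_0_nat)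
  have "p ^ a * (p ^ a * m choose p ^ a) = p ^ a * (m * u)"
    using times_binomial_minus1_eq[OF p0, of "p ^ a * m"] by (simp add: u_def mult.assoc)
  then show eq: "p ^ a * m choose p ^ a = m * u" using p0 by (metis nat_mult_eq_cancel1)
  have "p ^ a * m choose p ^ a > 0" using m by simp
  then have "u > 0" unfolding eq by simp
  then have "multiplicity p (m * u) = multiplicity p m + multiplicity p u"
    using m p by (simp add: prime_elem_multiplicity_mult_distrib)
  with const_p_fac[OF m p, of a] have "multiplicity p u = 0" by (simp add: eq)
  with \<open>u > 0\<close> p show "\<not> p dvd u" by (simp add: prime_elem_multiplicity_eq_zero_iff)
qed

lemma primepow_factors_1 [simp]: "primepow_factors (1::nat) = {}"
  by (auto simp: primepow_factors_def)

text \<open>Used in the induction over prime factors: each further prime opens exactly one new digit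
  position.\<close>

lemma primepow_factors_times_prime:
  fixes p g :: nat
  assumes p: "prime p" and g: "g > 0"
  shows "primepow_factors (p * g) = insert (p ^ Suc (multiplicity p g)) (primepow_factors g)"
    and "p ^ Suc (multiplicity p g) \<notin> primepow_factors g"
proof -
  have "r ^ k dvd p * g \<longleftrightarrow> r ^ k dvd g \<or> r ^ k = p ^ Suc (multiplicity p g)"
    if "prime r" "k > 0" for r k
  proof (cases "r = p")
    case True
    have "multiplicity p (p * g) = Suc (multiplicity p g)"
      using p g by (intro multiplicity_times_same) auto
    then have "p ^ k dvd p * g \<longleftrightarrow> k \<le> Suc (multiplicity p g)"
      using p g by (subst power_dvd_iff_le_multiplicity) auto
    moreover have "p ^ k dvd g \<longleftrightarrow> k \<le> multiplicity p g"
      using p g by (subst power_dvd_iff_le_multiplicity) auto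
    ultimately show ?thesis
      using True p by (auto simp: le_Suc_eq prime_nat_iff power_inject_exp simp del: power_Suc)
  next
    case False
    have "coprime (r ^ k) p"
      using False p that by (simp add: primes_coprime)
    moreover have "r ^ k \<noteq> p ^ Suc (multiplicity p g)"
      using False p that by (metis prime_dvd_power primes_dvd_imp_eq dvd_power zero_less_Suc)
    ultimately show ?thesis by (simp add: coprime_dvd_mult_right_iff)
  qed
  then show "primepow_factors (p * g) = insert (p ^ Suc (multiplicity p g)) (primepow_factors g)"
    using p by (auto simp: primepow_factors_def primepow_def simp del: power_Suc)
  have "\<not> p ^ Suc (multiplicity p g) dvd g"
    using p g by (subst power_dvd_iff_le_multiplicity) auto
  then show "p ^ Suc (multiplicity p g) \<notin> primepow_factors g"
    by (simp add: primepow_factors_def)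
qed

lemma primepow_factors_mono: "g dvd n \<Longrightarrow> primepow_factors g \<subseteq> primepow_factors n"
  by (auto simp: primepow_factors_def intro: dvd_trans)

lemma primepow_gt_1: "q \<in> primepow_factors n \<Longrightarrow> q > (1::nat)"
  using primepow_gt_Suc_0 by (auto simp: primepow_factors_def)

text \<open>A prime occurs below one \<open>q\<close> for each exponent up to its multiplicity. The
  product will count the digit vectors.\<close>

lemma prod_aprimedivisor_primepow_factors:
  assumes "n > (0::nat)"
  shows "(\<Prod>q\<in>primepow_factors n. aprimedivisor q) = n"
proof -
  have "(\<Prod>q\<in>primepow_factors n. aprimedivisor q) = prod_mset (prime_factorization n)"
    using assms unfolding prod_unfold_prod_mset
    by (subst aprimedivisor_primepow_factors_conv_prime_factorization) auto
  then show ?thesis using assms by (simp add: prod_mset_prime_factorization_nat)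
qed

text \<open>The last hypothesis says that \<open>x\<close> is a multiple of \<open>n / g\<close>;
  for \<open>g = n\<close> every residue is covered. Smaller \<open>g\<close> serves the induction
  and later confines the digits to divisors of \<open>g\<close>, which gives the size
  bounds.\<close>

lemma cong_primepow_choose_sum:
  fixes g n x :: nat
  assumes "n > 0" "g dvd n" "n dvd g * x"
  shows "\<exists>c. (\<forall>q\<in>primepow_factors g. c q < aprimedivisor q) \<and>
     [x = (\<Sum>q\<in>primepow_factors g. c q * (n choose q))] (mod n)"
  using assms
proof (induction g arbitrary: x rule: prime_divisors_induct)
  case zero
  then show ?case by simp
next
  case (unit g)
  then show ?case by (simp add: cong_0_iff primepow_factors_1[unfolded One_nat_def])
next
  case (factor p g)
  define a where "a = multiplicity p g"
  define q where "q = p ^ Suc a"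
  have p: "prime p" by fact
  have g: "g > 0" using factor.prems by (auto intro!: Nat.gr0I)
  \<comment> \<open>With \<open>l = n / (p * g)\<close>, \<open>x\<close> is a multiple of
    \<open>l\<close>, while the induction hypothesis asks for a multiple of
    \<open>p * l\<close>.\<close>
  from factor.prems(2) obtain l where n: "n = p * g * l" by (elim dvdE)
  with factor.prems(1) have l: "l > 0" by (auto intro!: Nat.gr0I)
  obtain h where h: "g = p ^ a * h" "\<not> p dvd h"
    using multiplicity_decompose'[of g p] g p unfolding a_def by (metis not_prime_unit less_irrefl)
  have n_q: "n = q * (h * l)" unfolding n by (subst h(1)) (simp add: q_def ac_simps)
  have "h * l > 0" using factor.prems(1) n_q by (auto intro!: Nat.gr0I)
  then obtain u where u: "n choose q = h * l * u" "\<not> p dvd u"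
    using choose_prime_power_cofactor[of "h * l" p "Suc a"] p unfolding n_q q_def by metis
  \<comment> \<open>\<open>p\<close> divides neither \<open>h\<close> nor \<open>u\<close>, so
    \<open>w\<close> is invertible modulo \<open>p\<close>.\<close>
  define w where "w = h * u"
  have w: "n choose q = l * w" by (simp add: w_def u(1) ac_simps)
  have "coprime w p"
    using prime_imp_coprime[OF p h(2)] prime_imp_coprime[OF p u(2)]
    by (simp add: w_def coprime_commute)
  then obtain v where v: "[w * v = 1] (mod p)"
    using cong_solve_coprime_nat[of w p] by auto
  obtain y where y: "x = l * y"
  proof -
    have "p * g * l dvd p * g * x" using factor.prems(3) n by simp
    then have "l dvd x" using p g by (simp add: prime_gt_0_nat)
    then show ?thesis using that by (elim dvdE)
  qed
  \<comment> \<open>This digit makes \<open>x - d * (n choose q)\<close>, which equals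
    \<open>l * (y - d * w)\<close>, divisible by \<open>p * l\<close>.\<close>
  define d where "d = (v * y) mod p"
  have d: "d < p" using p by (simp add: d_def prime_gt_0_nat)
  have dw: "[d * w = y] (mod p)"
  proof -
    have "[d * w = v * y * w] (mod p)" unfolding d_def by (intro cong_mult) auto
    also have "v * y * w = w * v * y" by (simp add: ac_simps)
    also have "[\<dots> = 1 * y] (mod p)" using v by (intro cong_mult) auto
    finally show ?thesis by simp
  qed
  \<comment> \<open>Congruent to \<open>x - d * (n choose q)\<close> modulo \<open>n\<close>; the
    factor \<open>n - 1\<close> stands for -1 and avoids truncated subtraction.\<close>
  define x' where "x' = x + (n - 1) * (d * (n choose q))"
  have x_x': "[x = d * (n choose q) + x'] (mod n)"
  proof -
    have "d * (n choose q) + x' = x + (n - 1 + 1) * (d * (n choose q))"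
      unfolding x'_def by (simp add: distrib_right)
    also have "\<dots> = x + n * (d * (n choose q))" using factor.prems(1) by simp
    finally show ?thesis by (simp add: cong_def)
  qed
  have "[y + (n - 1) * (d * w) = d * w + (n - 1) * (d * w)] (mod p)"
    using dw by (intro cong_add) (auto simp: cong_sym)
  also have "d * w + (n - 1) * (d * w) = (n - 1 + 1) * (d * w)" by (simp add: distrib_right)
  also have "\<dots> = p * (g * l * (d * w))" using factor.prems(1) n by (simp add: ac_simps)
  finally have "p dvd y + (n - 1) * (d * w)" by (metis cong_dvd_iff dvd_triv_left)
  then have "p * (g * l) dvd (y + (n - 1) * (d * w)) * (g * l)" by (intro mult_dvd_mono) auto
  moreover have "g * x' = (y + (n - 1) * (d * w)) * (g * l)"
    unfolding x'_def y w by (simp only: distrib_left distrib_right ac_simps)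
  ultimately have "n dvd g * x'" unfolding n by (simp only: ac_simps)
  with factor.IH[of x'] factor.prems n obtain c where
    c: "\<forall>q\<in>primepow_factors g. c q < aprimedivisor q"
       "[x' = (\<Sum>q\<in>primepow_factors g. c q * (n choose q))] (mod n)"
    by (metis dvd_mult_left dvd_mult_right)
  have new: "primepow_factors (p * g) = insert q (primepow_factors g)" "q \<notin> primepow_factors g"
    using primepow_factors_times_prime[OF p g] unfolding q_def a_def by blast+
  have fin: "finite (primepow_factors g)" using g by (simp add: finite_primepow_factors)
  have ap: "aprimedivisor q = p" using p by (simp add: q_def aprimedivisor_prime_power del: power_Suc)
  have "(\<Sum>r\<in>primepow_factors (p * g). (c(q := d)) r * (n choose r)) =
      d * (n choose q) + (\<Sum>r\<in>primepow_factors g. c r * (n choose r))"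
    unfolding new(1) using new(2) fin by (auto intro!: sum.cong)
  moreover have "[x = d * (n choose q) + (\<Sum>r\<in>primepow_factors g. c r * (n choose r))] (mod n)"
    using x_x' c(2) by (meson cong_add cong_refl cong_trans)
  ultimately have "[x = (\<Sum>r\<in>primepow_factors (p * g). (c(q := d)) r * (n choose r))] (mod n)"
    by simp
  moreover have "\<forall>r\<in>primepow_factors (p * g). (c(q := d)) r < aprimedivisor r"
    using new(1) c(1) d ap by auto
  ultimately show ?case by blast
qed

section \<open>Digit vectors and their sums\<close>

text \<open>Extensional functions, so that the set is finite and its cardinality is the product of
  the digit ranges.\<close>

definition prime_power_digits :: "nat \<Rightarrow> (nat \<Rightarrow> nat) set" where
  "prime_power_digits n = (\<Pi>\<^sub>E q\<in>primepow_factors n. {..<aprimedivisor q})"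

text \<open>The coefficients are left unbounded, since sums of digit vectors must be evaluated
  before any carrying.\<close>

definition choose_sum :: "nat \<Rightarrow> (nat \<Rightarrow> nat) \<Rightarrow> nat" where
  "choose_sum n c = (\<Sum>q\<in>primepow_factors n. c q * (n choose q))"

text \<open>Every residue is hit, by the case \<open>g = n\<close> of
  \<open>cong_primepow_choose_sum\<close>. There are exactly \<open>n\<close> digit vectors, so
  injectivity follows by counting.\<close>

lemma choose_sum_mod_bij:
  assumes n: "n > 0"
  shows "bij_betw (\<lambda>c. choose_sum n c mod n) (prime_power_digits n) {..<n}"
proof -
  have fin: "finite (primepow_factors n)" using n by (simp add: finite_primepow_factors)
  have card: "card (prime_power_digits n) = n"
    using prod_aprimedivisor_primepow_factors[OF n] fin
    by (simp add: prime_power_digits_def card_PiE)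
  have "x \<in> (\<lambda>c. choose_sum n c mod n) ` prime_power_digits n" if x: "x < n" for x
  proof -
    obtain c where c: "\<forall>q\<in>primepow_factors n. c q < aprimedivisor q"
      "[x = (\<Sum>q\<in>primepow_factors n. c q * (n choose q))] (mod n)"
      using cong_primepow_choose_sum[of n n x] n by auto
    define c' where "c' = restrict c (primepow_factors n)"
    have "choose_sum n c' = (\<Sum>q\<in>primepow_factors n. c q * (n choose q))"
      unfolding choose_sum_def c'_def by (intro sum.cong) auto
    with c(2) x have "x = choose_sum n c' mod n" by (simp add: cong_def)
    moreover have "c' \<in> prime_power_digits n"
      using c(1) by (auto simp: prime_power_digits_def c'_def)
    ultimately show ?thesis by blast
  qed
  then have img: "(\<lambda>c. choose_sum n c mod n) ` prime_power_digits n = {..<n}"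
    using n by auto
  have "finite (prime_power_digits n)"
    unfolding prime_power_digits_def using fin by (intro finite_PiE) auto
  then have "inj_on (\<lambda>c. choose_sum n c mod n) (prime_power_digits n)"
    using img card by (intro eq_card_imp_inj_on) auto
  with img show ?thesis by (simp add: bij_betw_def)
qed


section \<open>Size bounds and carrying\<close>

text \<open>Common source of the bounds for carries and for generators: digits outside the divisors
  of \<open>g\<close> are set to 0, and a digit at \<open>q\<close> is below
  \<open>aprimedivisor q\<close>, hence below \<open>q\<close>, as
  \<open>sum_weighted_choose_le\<close> requires.\<close>

lemma cong_choose_sum_le:
  fixes g n x :: nat
  assumes n: "n > 0" "g dvd n" "n dvd g * x"
    and m: "\<And>q. q \<in> primepow_factors g \<Longrightarrow> 2 * q \<le> m" "2 * m \<le> n"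
  shows "\<exists>c. [x = choose_sum n c] (mod n) \<and> choose_sum n c \<le> n choose m"
proof -
  obtain c where c: "\<forall>q\<in>primepow_factors g. c q < aprimedivisor q"
    "[x = (\<Sum>q\<in>primepow_factors g. c q * (n choose q))] (mod n)"
    using cong_primepow_choose_sum[OF n] by blast
  define c' where "c' = (\<lambda>q. if q \<in> primepow_factors g then c q else 0)"
  have "choose_sum n c' = (\<Sum>q\<in>primepow_factors g. c q * (n choose q))"
    unfolding choose_sum_def c'_def using n(1) primepow_factors_mono[OF n(2)]
    by (intro sum.mono_neutral_cong_right) (auto simp: finite_primepow_factors)
  moreover have "c q < q" if "q \<in> primepow_factors g" for q
    using that c(1) aprimedivisor_le_nat[of q] primepow_gt_1[of q g] by fastforce
  then have "(\<Sum>q\<in>primepow_factors g. c q * (n choose q)) \<le> n choose m"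
    using m by (intro sum_weighted_choose_le) auto
  ultimately show ?thesis using c(2) by metis
qed

lemma choose_sum_add: "choose_sum n (\<lambda>q. c q + d q) = choose_sum n c + choose_sum n d"
  by (simp add: choose_sum_def distrib_right sum.distrib)

lemma choose_sum_single:
  assumes "n > 0" "q \<in> primepow_factors n"
  shows "choose_sum n (\<lambda>r. if r = q then a else 0) = a * (n choose q)"
proof -
  have "choose_sum n (\<lambda>r. if r = q then a else 0) =
      (\<Sum>r\<in>primepow_factors n. if r = q then a * (n choose r) else 0)"
    unfolding choose_sum_def by (intro sum.cong) auto
  then show ?thesis using assms by (simp add: finite_primepow_factors)
qed

lemma choose_sum_restrict: "choose_sum n (restrict c (primepow_factors n)) = choose_sum n c"
  unfolding choose_sum_def by (intro sum.cong) auto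

lemma proper_divisor_double_le:
  fixes d n :: nat
  assumes "d dvd n" "d \<noteq> n" "n > 0"
  shows "2 * d \<le> n"
proof -
  obtain e where e: "n = d * e" using assms(1) by (elim dvdE)
  with assms have "e \<ge> 2" by (cases e rule: nat.exhaust) (auto simp: Suc_le_eq intro!: Nat.gr0I)
  then show ?thesis using e by simp
qed

text \<open>
  A digit that is too large at \<open>q\<close> is lowered by \<open>p = aprimedivisor q\<close>; the digit sum replacing
  \<open>p * (n choose q)\<close> is smaller, so the value itself is the termination measure.
\<close>
lemma choose_sum_carry:
  assumes n: "n > 0" and not_pp: "\<not> primepow n"
  shows "\<exists>d\<in>prime_power_digits n. choose_sum n d \<le> choose_sum n c \<and>
     [choose_sum n d = choose_sum n c] (mod n)"
proof (induction "choose_sum n c" arbitrary: c rule: less_induct)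
  case less
  show ?case
  proof (cases "\<forall>q\<in>primepow_factors n. c q < aprimedivisor q")
    case True
    then have "restrict c (primepow_factors n) \<in> prime_power_digits n"
      by (auto simp: prime_power_digits_def)
    then show ?thesis
      by (intro bexI[of _ "restrict c (primepow_factors n)"]) (auto simp: choose_sum_restrict)
  next
    case False
    then obtain q where q: "q \<in> primepow_factors n" "aprimedivisor q \<le> c q"
      by (auto simp: not_less)
    define p where "p = aprimedivisor q"
    \<comment> \<open>As \<open>n\<close> is not a prime power, \<open>q\<close> is a proper
      divisor, at most half of \<open>n\<close>, where the growth estimates hold.\<close>
    have q_dvd: "q dvd n" and "q \<noteq> n" using q not_pp by (auto simp: primepow_factors_def)
    then have q_le: "2 * q \<le> n" using n by (intro proper_divisor_double_le)
    from q(1) have p: "prime p" "p dvd q"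
      using aprimedivisor_nat[of q] primepow_gt_1[of q n] by (auto simp: p_def)
    \<comment> \<open>Absorption gives \<open>n dvd q * (n choose q)\<close>, that is
      \<open>n dvd g * (p * (n choose q))\<close>. So the replacement needs digits only at divisors
      of \<open>g\<close>, all at most half of \<open>q\<close>.\<close>
    then obtain g where g: "q = p * g" by (elim dvdE)
    have g0: "g > 0" using g primepow_gt_1[OF q(1)] by (auto intro!: Nat.gr0I)
    have p2: "2 \<le> p" using p by (simp add: prime_ge_2_nat)
    have "g dvd n" using q_dvd g by (metis dvd_mult_right)
    moreover have "q * (n choose q) = n * ((n - 1) choose (q - 1))"
      using primepow_gt_1[OF q(1)] by (intro times_binomial_minus1_eq) simp
    then have "n dvd g * (p * (n choose q))" by (simp add: g ac_simps)
    moreover have "2 * r \<le> q" if "r \<in> primepow_factors g" for r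
    proof -
      have "r \<le> g" using that g0 by (intro dvd_imp_le) (auto simp: primepow_factors_def)
      then show ?thesis unfolding g using p2 by (rule mult_le_mono[rotated])
    qed
    ultimately obtain d where d: "[p * (n choose q) = choose_sum n d] (mod n)"
      "choose_sum n d \<le> n choose q"
      using cong_choose_sum_le[of n g "p * (n choose q)" q] n q_le by auto
    define c0 where "c0 = c(q := c q - p)"
    have "c = (\<lambda>r. c0 r + (if r = q then p else 0))"
      using q(2) by (auto simp: c0_def p_def)
    then have c: "choose_sum n c = choose_sum n c0 + p * (n choose q)"
      using choose_sum_add choose_sum_single[OF n q(1)] by metis
    define c' where "c' = (\<lambda>r. c0 r + d r)"
    have c': "choose_sum n c' = choose_sum n c0 + choose_sum n d"
      unfolding c'_def by (rule choose_sum_add)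
    have "n choose q > 0" using q_le by simp
    then have "n choose q < p * (n choose q)" using p2 by simp
    with d(2) have "choose_sum n d < p * (n choose q)" by (rule le_less_trans)
    then have less_c: "choose_sum n c' < choose_sum n c" unfolding c c' by simp
    have cong_c: "[choose_sum n c' = choose_sum n c] (mod n)"
      unfolding c c' using d(1) by (intro cong_add) (auto simp: cong_sym)
    from less.hyps[OF less_c] less_c cong_c show ?thesis
      by (meson cong_trans less_imp_le order_trans)
  qed
qed

text \<open>If \<open>i\<close> is a digit position, the single digit 1 works. Otherwise absorption
  yields \<open>n dvd gcd n i * (n choose i)\<close>, so digits at prime powers dividing
  \<open>gcd n i\<close> suffice; these are proper divisors of \<open>i\<close>.\<close>

lemma choose_ge_choose_sum:
  assumes n: "n > 0" and i: "0 < i" "2 * i \<le> n"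
  shows "\<exists>c. choose_sum n c \<le> n choose i \<and> [choose_sum n c = n choose i] (mod n)"
proof (cases "i \<in> primepow_factors n")
  case True
  show ?thesis
    by (rule exI[of _ "\<lambda>r. if r = i then 1 else 0"]) (simp add: choose_sum_single[OF n True])
next
  case False
  have "i * (n choose i) = n * ((n - 1) choose (i - 1))"
    using i(1) by (rule times_binomial_minus1_eq)
  then have "n dvd gcd (n * (n choose i)) (i * (n choose i))" by simp
  then have "n dvd gcd n i * (n choose i)" by (simp add: gcd_mult_distrib_nat mult.commute)
  moreover have "2 * q \<le> i" if "q \<in> primepow_factors (gcd n i)" for q
    using that False i(1) by (intro proper_divisor_double_le) (auto simp: primepow_factors_def)
  ultimately show ?thesis
    using cong_choose_sum_le[of n "gcd n i" "n choose i" i] n i(2) by (auto simp: cong_sym_eq)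
qed

section \<open>The membership criterion\<close>

lemma mem_binomial_semigroup_iff:
  assumes n: "n > 1" and not_pp: "\<not> primepow n"
  shows "x \<in> binomial_semigroup n \<longleftrightarrow>
     (\<exists>c\<in>prime_power_digits n. choose_sum n c \<le> x \<and> [choose_sum n c = x] (mod n))"
proof
  \<comment> \<open>With unrestricted coefficients \<open>T\<close> is visibly closed under
    addition; \<open>choose_sum_carry\<close> restores proper digits at the end.\<close>
  define T where "T = {x. \<exists>c. choose_sum n c \<le> x \<and> [choose_sum n c = x] (mod n)}"
  assume "x \<in> binomial_semigroup n"
  moreover have "(\<lambda>i. n choose i) ` {1..n - 1} \<subseteq> T"
  proof safe
    fix i assume i: "i \<in> {1..n - 1}"
    show "n choose i \<in> T"
    proof (cases "2 * i \<le> n")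
      case True
      then show ?thesis using choose_ge_choose_sum[of n i] n i by (simp add: T_def)
    next
      case False
      then have "n choose (n - i) \<in> T"
        using choose_ge_choose_sum[of n "n - i"] n i by (simp add: T_def)
      then show ?thesis using i n by (subst binomial_symmetric) auto
    qed
  qed
  moreover have "add_submonoid T"
    unfolding add_submonoid_def
  proof safe
    show "0 \<in> T" by (auto simp: T_def choose_sum_def intro!: exI[of _ "\<lambda>_. 0"])
  next
    fix x y assume "x \<in> T" "y \<in> T"
    then obtain c d where "choose_sum n c \<le> x" "[choose_sum n c = x] (mod n)"
      "choose_sum n d \<le> y" "[choose_sum n d = y] (mod n)" by (auto simp: T_def)
    then show "x + y \<in> T"
      by (auto simp: T_def choose_sum_add intro!: exI[of _ "\<lambda>q. c q + d q"] cong_add)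
  qed
  ultimately have "x \<in> T"
    unfolding binomial_semigroup_def generated_submonoid_def by (metis hull_minimal subsetD)
  then obtain c where "choose_sum n c \<le> x" "[choose_sum n c = x] (mod n)" by (auto simp: T_def)
  with choose_sum_carry[of n c] n not_pp
  show "\<exists>c\<in>prime_power_digits n. choose_sum n c \<le> x \<and> [choose_sum n c = x] (mod n)"
    by (meson cong_trans le_trans less_trans zero_less_one)
next
  assume "\<exists>c\<in>prime_power_digits n. choose_sum n c \<le> x \<and> [choose_sum n c = x] (mod n)"
  then obtain c where c: "choose_sum n c \<le> x" "[choose_sum n c = x] (mod n)" by blast
  have S: "add_submonoid (binomial_semigroup n)"
    unfolding binomial_semigroup_def by (rule add_submonoid_generated)
  have gen: "n choose i \<in> binomial_semigroup n" if "0 < i" "i < n" for i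
    unfolding binomial_semigroup_def using that by (intro generated_submonoid_incl imageI) auto
  have "n choose q \<in> binomial_semigroup n" if "q \<in> primepow_factors n" for q
    using that not_pp n primepow_gt_1[OF that] dvd_imp_le[of q n]
    by (intro gen) (auto simp: primepow_factors_def le_less)
  moreover have "(\<Sum>q\<in>A. c q * (n choose q)) \<in> binomial_semigroup n"
    if "finite A" "\<And>q. q \<in> A \<Longrightarrow> n choose q \<in> binomial_semigroup n" for A
    using that
  proof (induction A rule: finite_induct)
    case (insert q A)
    then show ?case
      using S add_submonoid_mult[OF S, of "n choose q" "c q"] by (simp add: add_submonoid_def)
  qed (use S in \<open>simp add: add_submonoid_def\<close>)
  ultimately have "choose_sum n c \<in> binomial_semigroup n"
    using n by (simp add: choose_sum_def finite_primepow_factors)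
  \<comment> \<open>The excess over the digit sum is a multiple of \<open>n = n choose 1\<close>,
    itself a generator.\<close>
  moreover obtain k where "x = choose_sum n c + k * n"
    using c cong_le_nat[of "choose_sum n c" x n] by (auto simp: cong_sym_eq add.commute)
  moreover have "k * n \<in> binomial_semigroup n"
    using gen[of 1] n by (intro add_submonoid_mult[OF S]) auto
  ultimately show "x \<in> binomial_semigroup n" using S by (simp add: add_submonoid_def)
qed

section \<open>Symmetric semigroups\<close>

text \<open>Negative numbers lie outside \<open>S\<close>, so everything above \<open>F\<close> lies
  inside. For a pseudo-Frobenius number \<open>x\<close>, the reflection \<open>F - x\<close> is in
  \<open>S\<close>; were it nonzero, adding it to \<open>x\<close> would put \<open>F\<close> into
  \<open>S\<close>.\<close>

lemma symmetric_semigroup: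
  fixes F :: int
  assumes S: "add_submonoid S" and sym: "\<And>x. x \<in> int ` S \<longleftrightarrow> F - x \<notin> int ` S"
  shows "Frobenius_number S = F" and "pseudo_Frobenius S = {F}" and "2 * int (genus S) = F + 1"
proof -
  have F: "F \<notin> int ` S" using sym[of 0] S by (force simp: add_submonoid_def)
  have gt_F: "x \<in> int ` S" if "x > F" for x
    using that by (subst sym) auto
  have le_F: "x \<le> F" if "x \<notin> int ` S" for x
    using that gt_F by (meson not_le)
  show "Frobenius_number S = F"
    unfolding Frobenius_number_def using F le_F by (intro Greatest_equality)
  show "pseudo_Frobenius S = {F}"
  proof (intro equalityI subsetI)
    fix x assume x: "x \<in> pseudo_Frobenius S"
    then have "F - x \<in> int ` S" using sym[of "F - x"] by (simp add: pseudo_Frobenius_def)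
    then obtain s where s: "s \<in> S" "F - x = int s" by auto
    have "s = 0"
    proof (rule ccontr)
      assume "s \<noteq> 0"
      then have "x + int s \<in> int ` S" using x s(1) by (auto simp: pseudo_Frobenius_def)
      with s(2) F show False by (metis add.commute diff_add_cancel)
    qed
    then show "x \<in> {F}" using s(2) by simp
  qed (use F gt_F in \<open>auto simp: pseudo_Frobenius_def\<close>)
  \<comment> \<open>Reflection exchanges the gaps with the elements up to \<open>F\<close>, so the
    gaps are half of \<open>{0..F}\<close>.\<close>
  have "bij_betw (\<lambda>x. F - x) (int ` (- S)) (int ` S \<inter> {..F})"
  proof (rule bij_betw_byWitness[where f' = "\<lambda>x. F - x"])
    have "F - int x \<in> int ` S" if "x \<notin> S" for x
      using that by (subst sym) auto
    then show "(\<lambda>x. F - x) ` (int ` (- S)) \<subseteq> int ` S \<inter> {..F}" by auto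
    show "(\<lambda>x. F - x) ` (int ` S \<inter> {..F}) \<subseteq> int ` (- S)"
    proof safe
      fix s assume s: "s \<in> S" "int s \<le> F"
      have "F - int s \<notin> int ` S" using sym[of "int s"] s(1) by blast
      then show "F - int s \<in> int ` (- S)"
        using s(2) by (intro image_eqI[of _ _ "nat (F - int s)"]) (auto simp: image_iff)
    qed
  qed auto
  then have card_eq: "card (int ` (- S)) = card (int ` S \<inter> {..F})" by (rule bij_betw_same_card)
  have "int ` (- S) \<subseteq> {0..F}" using le_F by (force simp: image_iff)
  then have split: "{0..F} = int ` (- S) \<union> (int ` S \<inter> {..F})"
    by (auto simp: image_iff) (metis Compl_iff nonneg_int_cases)
  have "finite (int ` (- S) \<union> (int ` S \<inter> {..F}))" unfolding split[symmetric] by simp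
  then have "card {0..F} = card (int ` (- S)) + card (int ` S \<inter> {..F})"
    unfolding split by (intro card_Un_disjoint) auto
  then have "card {0..F} = 2 * genus S"
    using card_eq by (simp add: genus_def card_image)
  \<comment> \<open>Ensures that \<open>{0..F}\<close> has \<open>F + 1\<close> elements, also when
    it is empty.\<close>
  moreover have "-1 \<le> F" by (rule le_F) auto
  ultimately show "2 * int (genus S) = F + 1" by simp
qed

section \<open>Apery set and symmetry of the binomial semigroup\<close>

context
  fixes n :: nat
  assumes n: "n > 1" and not_pp: "\<not> primepow n"
begin

lemma choose_sum_digits_inj:
  assumes "c \<in> prime_power_digits n" "d \<in> prime_power_digits n"
    "[choose_sum n c = choose_sum n d] (mod n)"
  shows "c = d"
  using bij_betw_imp_inj_on[OF choose_sum_mod_bij[of n]] n assms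
  by (auto simp: inj_on_def cong_def)

lemma ex_choose_sum_digits: "\<exists>c\<in>prime_power_digits n. [int (choose_sum n c) = x] (mod (int n))"
proof -
  have "nat (x mod int n) \<in> {..<n}" using n by (simp add: nat_less_iff)
  then obtain c where c: "c \<in> prime_power_digits n" "nat (x mod int n) = choose_sum n c mod n"
    using bij_betw_imp_surj_on[OF choose_sum_mod_bij[of n]] n by (auto simp: image_iff set_eq_iff)
  then have "x mod int n = int (choose_sum n c) mod int n"
    using n by (metis int_nat_eq less_trans of_nat_0_less_iff pos_mod_sign zero_less_one zmod_int)
  with c(1) show ?thesis by (auto simp: cong_def)
qed

text \<open>Only \<open>c\<close> has its digit sum in the residue class of \<open>x\<close>, so the
  existential criterion becomes one inequality. Integer \<open>x\<close> admits the possibly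
  negative \<open>s - n\<close> and \<open>F - x\<close>.\<close>

lemma mem_int_binomial_semigroup_iff:
  assumes c: "c \<in> prime_power_digits n" "[int (choose_sum n c) = x] (mod (int n))"
  shows "x \<in> int ` binomial_semigroup n \<longleftrightarrow> int (choose_sum n c) \<le> x"
proof
  assume "x \<in> int ` binomial_semigroup n"
  then obtain y where y: "x = int y" "y \<in> binomial_semigroup n" by blast
  then obtain d where d: "d \<in> prime_power_digits n" "choose_sum n d \<le> y"
    "[choose_sum n d = y] (mod n)"
    using mem_binomial_semigroup_iff[OF n not_pp] by auto
  have "[choose_sum n c = y] (mod n)" using c(2) y(1) by (simp add: cong_int_iff)
  with d(3) have "[choose_sum n c = choose_sum n d] (mod n)" by (meson cong_sym cong_trans)
  with c(1) d(1) have "c = d" by (rule choose_sum_digits_inj)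
  with d(2) y(1) show "int (choose_sum n c) \<le> x" by simp
next
  assume le: "int (choose_sum n c) \<le> x"
  then obtain y where y: "x = int y" by (metis nonneg_int_cases of_nat_0_le_iff order_trans)
  with le c(2) have "choose_sum n c \<le> y" "[choose_sum n c = y] (mod n)"
    by (simp_all add: cong_int_iff)
  with c(1) have "y \<in> binomial_semigroup n"
    using mem_binomial_semigroup_iff[OF n not_pp] by blast
  with y show "x \<in> int ` binomial_semigroup n" by simp
qed

text \<open>\<open>s\<close> and \<open>s - n\<close> share a residue class, so \<open>s\<close> is
  an Apery element iff it is the least element of its class, which is the digit sum.\<close>

lemma Apery_binomial_semigroup:
  "Apery (binomial_semigroup n) n = choose_sum n ` prime_power_digits n"
proof -
  have "s \<in> Apery (binomial_semigroup n) n \<longleftrightarrow> s \<in> choose_sum n ` prime_power_digits n" for s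
  proof -
    obtain c where c: "c \<in> prime_power_digits n" "[int (choose_sum n c) = int s] (mod (int n))"
      using ex_choose_sum_digits by blast
    have shift: "[int (choose_sum n c) = int s - int n] (mod (int n))"
      using c(2) by (simp add: cong_def)
    have "s \<in> binomial_semigroup n \<longleftrightarrow> choose_sum n c \<le> s"
      using mem_int_binomial_semigroup_iff[OF c] by auto
    then have "s \<in> Apery (binomial_semigroup n) n \<longleftrightarrow>
        choose_sum n c \<le> s \<and> \<not> int (choose_sum n c) \<le> int s - int n"
      using mem_int_binomial_semigroup_iff[OF c(1) shift] by (simp add: Apery_def)
    also have "\<dots> \<longleftrightarrow> choose_sum n c = s"
    proof safe
      assume le: "choose_sum n c \<le> s" "\<not> int (choose_sum n c) \<le> int s - int n"
      have "[choose_sum n c = s] (mod n)" using c(2) by (simp add: cong_int_iff)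
      then obtain k where k: "s = k * n + choose_sum n c"
        using le(1) cong_le_nat[of "choose_sum n c" s n] by (auto simp: cong_sym_eq)
      with le(2) have "k * n < 1 * n" by (simp flip: of_nat_mult)
      then have "k = 0" by (subst (asm) mult_less_cancel2) simp
      with k show "choose_sum n c = s" by simp
    qed (use n in auto)
    also have "\<dots> \<longleftrightarrow> s \<in> choose_sum n ` prime_power_digits n"
    proof safe
      fix d assume d: "d \<in> prime_power_digits n" "s = choose_sum n d"
      then have "c = d" using c by (intro choose_sum_digits_inj) (simp_all add: cong_int_iff)
      with d show "choose_sum n c = choose_sum n d" by simp
    qed (use c in auto)
    finally show ?thesis .
  qed
  then show ?thesis by blast
qed

text \<open>Complementing each digit to \<open>aprimedivisor q - 1\<close> gives \<open>d\<close>,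
  whose digit sum together with that of \<open>c\<close> is \<open>F + n\<close>.\<close>

lemma binomial_semigroup_symmetric:
  defines "F \<equiv> (\<Sum>q\<in>primepow_factors n. (int (aprimedivisor q) - 1) * int (n choose q)) - int n"
  shows "x \<in> int ` binomial_semigroup n \<longleftrightarrow> F - x \<notin> int ` binomial_semigroup n"
proof -
  obtain c where c: "c \<in> prime_power_digits n" "[int (choose_sum n c) = x] (mod (int n))"
    using ex_choose_sum_digits by blast
  define d where "d = (\<lambda>q\<in>primepow_factors n. aprimedivisor q - 1 - c q)"
  have c_less: "c q < aprimedivisor q" if "q \<in> primepow_factors n" for q
    using that c(1) by (auto simp: prime_power_digits_def)
  then have d: "d \<in> prime_power_digits n"
    by (force simp: prime_power_digits_def d_def)
  have "int (choose_sum n c) + int (choose_sum n d) =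
      (\<Sum>q\<in>primepow_factors n. int (c q + d q) * int (n choose q))"
    unfolding of_nat_add[symmetric] choose_sum_add[symmetric] by (simp add: choose_sum_def)
  also have "\<dots> = (\<Sum>q\<in>primepow_factors n. (int (aprimedivisor q) - 1) * int (n choose q))"
    using c_less by (intro sum.cong) (fastforce simp: d_def)+
  finally have cd: "int (choose_sum n d) = F + int n - int (choose_sum n c)"
    by (simp add: F_def)
  obtain k where k: "x = int (choose_sum n c) + int n * k"
    using c(2) by (metis cong_iff_lin)
  \<comment> \<open>The shift from \<open>k\<close> to \<open>k + 1\<close> comes from the
    \<open>- n\<close> in \<open>F\<close>; exactly one of \<open>0 \<le> k\<close> and
    \<open>k + 1 \<le> 0\<close> holds.\<close>
  have Fx: "F - x = int (choose_sum n d) - int n * (k + 1)"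
    unfolding cd k by (simp add: algebra_simps)
  then have d_cong: "[int (choose_sum n d) = F - x] (mod (int n))"
    by (simp add: cong_iff_dvd_diff)
  have "x \<in> int ` binomial_semigroup n \<longleftrightarrow> 0 \<le> k"
    using mem_int_binomial_semigroup_iff[OF c] n unfolding k by (simp add: zero_le_mult_iff)
  moreover have "F - x \<in> int ` binomial_semigroup n \<longleftrightarrow> k + 1 \<le> 0"
    using mem_int_binomial_semigroup_iff[OF d d_cong] n unfolding Fx
    by (simp add: mult_le_0_iff)
  ultimately show ?thesis by linarith
qed

end

section \<open>Passage to the indexing by primes and exponents\<close>

text \<open>A prime power determines its base and exponent, and it divides \<open>n\<close> iff the
  exponent is at most the multiplicity, which is \<open>k i\<close> at \<open>p i\<close>.\<close>

lemma primepow_factors_prod_bij: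
  fixes n t :: nat and p k :: "nat \<Rightarrow> nat"
  assumes p: "\<And>i. i \<in> {1..t} \<Longrightarrow> prime (p i)" "inj_on p {1..t}"
    and n: "n = (\<Prod>i=1..t. p i ^ k i)"
  shows "bij_betw (\<lambda>(i, j). p i ^ j) (SIGMA i:{1..t}. {1..k i}) (primepow_factors n)"
  unfolding bij_betw_def
proof
  have eqD: "i = i' \<and> j = j'"
    if "p i ^ j = p i' ^ j'" "i \<in> {1..t}" "i' \<in> {1..t}" "j \<ge> 1" "j' \<ge> 1" for i i' j j'
  proof -
    have "p i = p i'"
      using that p(1) aprimedivisor_prime_power[of "p i" j] aprimedivisor_prime_power[of "p i'" j']
      by simp
    then have i: "i = i'" using inj_onD[OF p(2)] that by blast
    have "p i > 1" using p(1)[OF that(2)] by (rule prime_gt_1_nat)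
    then show ?thesis using that(1) i power_inject_exp[of "p i" j j'] by simp
  qed
  show "inj_on (\<lambda>(i, j). p i ^ j) (SIGMA i:{1..t}. {1..k i})"
  proof (intro inj_onI, clarify)
    fix i j i' j' assume "i \<in> {1..t}" "j \<in> {1..k i}" "i' \<in> {1..t}" "j' \<in> {1..k i'}"
      "p i ^ j = p i' ^ j'"
    then show "i = i' \<and> j = j'" by (intro eqD) simp_all
  qed
  have mult: "multiplicity r n = (if r \<in> p ` {1..t} then k (inv_into {1..t} p r) else 0)"
    if "prime r" for r
  proof -
    \<comment> \<open>Reindexed by the primes themselves, the product has the form in which
      multiplicities can be read off.\<close>
    have eq: "n = (\<Prod>r\<in>p ` {1..t}. r ^ k (inv_into {1..t} p r))"
      unfolding n using p(2) by (subst prod.reindex) (auto intro!: prod.cong simp: inv_into_f_f)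
    show ?thesis
      unfolding eq using that p(1) by (intro multiplicity_prod_prime_powers) auto
  qed
  have n0: "n > 0" using p(1) by (auto simp: n intro!: prod_pos simp: prime_gt_0_nat)
  have dvd_iff: "r ^ j dvd n \<longleftrightarrow> j \<le> multiplicity r n" if "prime r" for r j
    using that n0 by (subst power_dvd_iff_le_multiplicity) auto
  show "(\<lambda>(i, j). p i ^ j) ` (SIGMA i:{1..t}. {1..k i}) = primepow_factors n"
  proof (intro equalityI subsetI)
    fix q assume "q \<in> (\<lambda>(i, j). p i ^ j) ` (SIGMA i:{1..t}. {1..k i})"
    then obtain i j where ij: "i \<in> {1..t}" "j \<in> {1..k i}" "q = p i ^ j" by auto
    have "multiplicity (p i) n = k i" using mult[OF p(1)] ij(1) p(2) by (simp add: inv_into_f_f)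
    with ij dvd_iff[OF p(1)] p(1) show "q \<in> primepow_factors n" by (simp add: primepow_factors_def)
  next
    fix q assume "q \<in> primepow_factors n"
    then obtain r j where q: "prime r" "j > 0" "q = r ^ j" "j \<le> multiplicity r n"
      using dvd_iff by (auto simp: primepow_factors_def primepow_def)
    then obtain i where i: "i \<in> {1..t}" "r = p i" using mult[of r] by (auto split: if_splits)
    with q mult[of r] p(2) show "q \<in> (\<lambda>(i, j). p i ^ j) ` (SIGMA i:{1..t}. {1..k i})"
      by (auto simp: inv_into_f_f intro!: image_eqI[of _ _ "(i, j)"])
  qed
qed

lemma sum_primepow_factors_prod:
  fixes n t :: nat and p k :: "nat \<Rightarrow> nat"
  assumes p: "\<And>i. i \<in> {1..t} \<Longrightarrow> prime (p i)" "inj_on p {1..t}"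
    and n: "n = (\<Prod>i=1..t. p i ^ k i)"
  shows "(\<Sum>i=1..t. \<Sum>j=1..k i. f (p i ^ j)) = (\<Sum>q\<in>primepow_factors n. f q)"
proof -
  have "(\<Sum>i=1..t. \<Sum>j=1..k i. f (p i ^ j)) =
      (\<Sum>x\<in>(SIGMA i:{1..t}. {1..k i}). f ((\<lambda>(i, j). p i ^ j) x))"
    by (subst sum.Sigma) (auto intro!: sum.cong)
  also have "\<dots> = (\<Sum>q\<in>primepow_factors n. f q)"
    by (rule sum.reindex_bij_betw[OF primepow_factors_prod_bij[OF p n]])
  finally show ?thesis .
qed


theorem corollary3p3:
  fixes n t :: nat and p k :: "nat \<Rightarrow> nat"
  assumes "t \<ge> 2"
    and "\<And>i. i \<in> {1..t} \<Longrightarrow> prime (p i)"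
    and "strict_mono_on {1..t} p"
    and "\<And>i. i \<in> {1..t} \<Longrightarrow> k i > 0"
    and "n = (\<Prod>i=1..t. p i ^ k i)"
  shows "(int ` Apery (binomial_semigroup n) n =
      {(\<Sum>i=1..t. \<Sum>j=1..k i. c i j * int (n choose (p i ^ j))) | c :: nat \<Rightarrow> nat \<Rightarrow> int.
        \<forall>i\<in>{1..t}. \<forall>j\<in>{1..k i}. 0 \<le> c i j \<and> c i j \<le> int (p i) - 1}) \<and>
     (Frobenius_number (binomial_semigroup n) =
      (\<Sum>i=1..t. \<Sum>j=1..k i. (int (p i) - 1) * int (n choose (p i ^ j))) - int n) \<and>
     (real (genus (binomial_semigroup n)) =
      (\<Sum>i=1..t. \<Sum>j=1..k i. (real (p i) - 1) / 2 * real (n choose (p i ^ j))) - (real n - 1) / 2) \<and>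
     (pseudo_Frobenius (binomial_semigroup n) =
      {(\<Sum>i=1..t. \<Sum>j=1..k i. (int (p i) - 1) * int (n choose (p i ^ j))) - int n}) \<and>
     (semigroup_type (binomial_semigroup n) = 1)"
proof -
  let ?S = "binomial_semigroup n" and ?Q = "primepow_factors n"
  let ?h = "\<lambda>(i, j). p i ^ j"
  note prime = assms(2) and n = assms(5)
  have inj: "inj_on p {1..t}" using assms(3) by (rule strict_mono_on_imp_inj_on)
  note bij = primepow_factors_prod_bij[OF prime inj n]
  have ap: "aprimedivisor (p i ^ j) = p i" if "i \<in> {1..t}" "j \<in> {1..k i}" for i j
    using that prime by (intro aprimedivisor_prime_power) auto
  have dvd: "p i dvd n" if "i \<in> {1..t}" for i
    unfolding n using that assms(4)[OF that] by (intro dvd_prodI[THEN dvd_trans[rotated]] dvd_power) auto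
  have t: "1 \<in> {1..t}" "2 \<in> {1..t}" using assms(1) by auto
  \<comment> \<open>Two distinct prime divisors exclude a prime power; this is where
    \<open>t \<ge> 2\<close> enters.\<close>
  have "p 1 \<noteq> p 2" using inj t by (auto dest: inj_onD)
  then have not_pp: "\<not> primepow n" using prime t dvd by (intro not_primepowI[of "p 1" "p 2"])
  have "n > 0" using prime by (auto simp: n intro!: prod_pos simp: prime_gt_0_nat)
  moreover have "p 1 \<le> n" using dvd[OF t(1)] calculation by (rule dvd_imp_le)
  ultimately have n1: "n > 1" using prime_gt_1_nat[OF prime[OF t(1)]] by linarith
  define M where "M = (\<Sum>q\<in>?Q. (int (aprimedivisor q) - 1) * int (n choose q))"
  have M: "(\<Sum>i=1..t. \<Sum>j=1..k i. (int (p i) - 1) * int (n choose (p i ^ j))) = M"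
  proof -
    have "(\<Sum>i=1..t. \<Sum>j=1..k i. (int (p i) - 1) * int (n choose (p i ^ j))) =
        (\<Sum>i=1..t. \<Sum>j=1..k i. (int (aprimedivisor (p i ^ j)) - 1) * int (n choose (p i ^ j)))"
      by (intro sum.cong refl) (simp add: ap)
    also have "\<dots> = M"
      unfolding M_def
      by (rule sum_primepow_factors_prod[OF prime inj n,
            of "\<lambda>q. (int (aprimedivisor q) - 1) * int (n choose q)"])
    finally show ?thesis .
  qed
  have choose_sum: "int (choose_sum n d) =
      (\<Sum>i=1..t. \<Sum>j=1..k i. int (d (p i ^ j)) * int (n choose (p i ^ j)))" for d
    using sum_primepow_factors_prod[OF prime inj n, of "\<lambda>q. int (d q) * int (n choose q)"]
    by (simp add: choose_sum_def)
  have "add_submonoid ?S"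
    unfolding binomial_semigroup_def by (rule add_submonoid_generated)
  note sym = symmetric_semigroup[OF this binomial_semigroup_symmetric[OF n1 not_pp, folded M_def]]
  have "int ` Apery ?S n =
      {(\<Sum>i=1..t. \<Sum>j=1..k i. c i j * int (n choose (p i ^ j))) | c :: nat \<Rightarrow> nat \<Rightarrow> int.
        \<forall>i\<in>{1..t}. \<forall>j\<in>{1..k i}. 0 \<le> c i j \<and> c i j \<le> int (p i) - 1}" (is "_ = ?R")
  proof (intro equalityI subsetI)
    fix x assume "x \<in> int ` Apery ?S n"
    then obtain d where d: "d \<in> prime_power_digits n" "x = int (choose_sum n d)"
      unfolding Apery_binomial_semigroup[OF n1 not_pp] by blast
    have "x = (\<Sum>i=1..t. \<Sum>j=1..k i. int (d (p i ^ j)) * int (n choose (p i ^ j)))"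
      unfolding d(2) by (rule choose_sum)
    moreover have "int (d (p i ^ j)) \<le> int (p i) - 1" if ij: "i \<in> {1..t}" "j \<in> {1..k i}" for i j
    proof -
      have "p i ^ j \<in> ?Q" using bij_betw_apply[OF bij, of "(i, j)"] ij by simp
      then have "d (p i ^ j) < p i" using d(1) ap[OF ij] by (fastforce simp: prime_power_digits_def PiE_iff)
      then show ?thesis by simp
    qed
    ultimately show "x \<in> ?R" by (auto intro!: exI[of _ "\<lambda>i j. int (d (p i ^ j))"])
  next
    fix x assume "x \<in> ?R"
    then obtain c where c: "\<And>i j. i \<in> {1..t} \<Longrightarrow> j \<in> {1..k i} \<Longrightarrow> 0 \<le> c i j \<and> c i j \<le> int (p i) - 1"
      and x: "x = (\<Sum>i=1..t. \<Sum>j=1..k i. c i j * int (n choose (p i ^ j)))" by blast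
    \<comment> \<open>The coefficients \<open>c\<close> are carried over to
      \<open>primepow_factors n\<close> along the inverse bijection; \<open>nat\<close> loses
      nothing because \<open>c i j\<close> is nonnegative there.\<close>
    define d where "d = (\<lambda>q\<in>?Q. nat (case_prod c (inv_into (SIGMA i:{1..t}. {1..k i}) ?h q)))"
    have d: "int (d (p i ^ j)) = c i j" if ij: "i \<in> {1..t}" "j \<in> {1..k i}" for i j
    proof -
      have "inv_into (SIGMA i:{1..t}. {1..k i}) ?h (?h (i, j)) = (i, j)"
        using bij ij by (intro inv_into_f_f) (auto simp: bij_betw_def)
      moreover have "p i ^ j \<in> ?Q" using bij_betw_apply[OF bij, of "(i, j)"] ij by simp
      ultimately show ?thesis using c[OF ij] by (simp add: d_def)
    qed
    have "d q < aprimedivisor q" if "q \<in> ?Q" for q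
    proof -
      have "q \<in> ?h ` (SIGMA i:{1..t}. {1..k i})"
        using that by (simp only: bij_betw_imp_surj_on[OF bij])
      then obtain i j where ij: "i \<in> {1..t}" "j \<in> {1..k i}" "q = p i ^ j" by auto
      then show ?thesis unfolding ij(3) ap[OF ij(1,2)] using d[OF ij(1,2)] c[OF ij(1,2)] by linarith
    qed
    then have "d \<in> prime_power_digits n" by (auto simp: prime_power_digits_def d_def)
    moreover have "x = int (choose_sum n d)"
      unfolding x choose_sum by (simp add: d)
    ultimately show "x \<in> int ` Apery ?S n"
      unfolding Apery_binomial_semigroup[OF n1 not_pp] by blast
  qed
  moreover have "real (genus ?S) =
      (\<Sum>i=1..t. \<Sum>j=1..k i. (real (p i) - 1) / 2 * real (n choose (p i ^ j))) - (real n - 1) / 2"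
  proof -
    have "2 * real (genus ?S) = real_of_int M - real n + 1"
      using arg_cong[OF sym(3), of real_of_int] by simp
    also have "real_of_int M = (\<Sum>i=1..t. \<Sum>j=1..k i. (real (p i) - 1) * real (n choose (p i ^ j)))"
      unfolding M[symmetric] by simp
    also have "\<dots> = 2 * (\<Sum>i=1..t. \<Sum>j=1..k i. (real (p i) - 1) / 2 * real (n choose (p i ^ j)))"
      by (simp add: sum_distrib_left)
    finally show ?thesis by (simp add: field_simps)
  qed
  ultimately show ?thesis
    unfolding M semigroup_type_def sym(1,2) by simp
qed

end
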